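(* Let $(X,T)$ be an $\overline F$-continuous topological dynamical system, where $X$ is a non-empty compact metric space with metric $d$ and $T:X\to X$ is continuous. Then all the points in $X$ are generic points.
   Context: $S_n$ denotes the group of permutations of $\{1,\dots,n\}$. For $x,y\in X$ define $\overline F(x,y)=\limsup_{n\to+\infty}\inf_{\sigma\in S_n}\frac1n\sum_{k=1}^n d(T^kx,T^{\sigma(k)}y)$. $(X,T)$ is $\overline F$-continuous if for every $x\in X$ and every $\varepsilon>0$ there is $\delta>0$ such that $\overline F(x,y)<\varepsilon$ whenever $d(x,y)<\delta$. A point $x\in X$ is generic if $\lim_{n\to+\infty}\frac1n\sum_{k=1}^n f(T^kx)$ exists for every continuous function $f$ on $X$. *)

theory Defs
  imports "HOL-Analysis.Analysis" "HOL-Combinatorics.Permutations"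
begin

text \<open>A metric space is a subset \<open>X\<close> of a type of class \<^class>\<open>metric_space\<close> with the induced
  metric \<^const>\<open>dist\<close>.\<close>

definition topological_dynamical_system :: "'a::metric_space set \<Rightarrow> ('a \<Rightarrow> 'a) \<Rightarrow> bool" where
  "topological_dynamical_system X T \<longleftrightarrow>
     X \<noteq> {} \<and> compact X \<and> continuous_on X T \<and> T ` X \<subseteq> X"

text \<open>The limit superior is taken in \<^typ>\<open>ereal\<close>, because \<^const>\<open>limsup\<close> requires a complete
  lattice; the infimum is over a finite non-empty set of reals. The term for \<open>n = 0\<close> is
  irrelevant to the limit superior.\<close>

definition Fbar :: "('a::metric_space \<Rightarrow> 'a) \<Rightarrow> 'a \<Rightarrow> 'a \<Rightarrow> ereal" where
  "Fbar T x y =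
     limsup (\<lambda>n. ereal (INF \<sigma>\<in>{\<sigma>. \<sigma> permutes {1..n}}.
       (1 / real n) * (\<Sum>k=1..n. dist ((T ^^ k) x) ((T ^^ \<sigma> k) y))))"

definition Fbar_continuous :: "'a::metric_space set \<Rightarrow> ('a \<Rightarrow> 'a) \<Rightarrow> bool" where
  "Fbar_continuous X T \<longleftrightarrow>
     (\<forall>x\<in>X. \<forall>\<epsilon>::real. \<epsilon> > 0 \<longrightarrow>
        (\<exists>\<delta>::real. \<delta> > 0 \<and> (\<forall>y\<in>X. dist x y < \<delta> \<longrightarrow> Fbar T x y < ereal \<epsilon>)))"

definition generic_point :: "'a::metric_space set \<Rightarrow> ('a \<Rightarrow> 'a) \<Rightarrow> 'a \<Rightarrow> bool" where
  "generic_point X T x \<longleftrightarrow>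
     x \<in> X \<and>
     (\<forall>f::'a \<Rightarrow> real. continuous_on X f \<longrightarrow>
        convergent (\<lambda>n. (1 / real n) * (\<Sum>k=1..n. f ((T ^^ k) x))))"

end

theory Submission
  imports Defs
begin

text \<open>Closeness in \<^const>\<open>Fbar\<close> forces the Birkhoff averages of a continuous function to be
  eventually close, because averages do not see the permutation. Hence the upper limit \<open>c\<close> of
  the averages at \<open>x\<close> is a lower bound of the upper limits at all points of the orbit closure
  of \<open>x\<close>. For \<open>a < c\<close> every point of the orbit closure therefore has a time segment with average
  above \<open>a\<close>, by compactness of bounded length. Cutting the orbit of \<open>x\<close> into such segments shows
  that its lower limit is at least \<open>a\<close>, so no invariant measures are needed.\<close>

section \<open>Birkhoff sums along orbits\<close>

definition birkhoff_sum :: "('a \<Rightarrow> 'a) \<Rightarrow> ('a \<Rightarrow> real) \<Rightarrow> nat \<Rightarrow> 'a \<Rightarrow> real" where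
  "birkhoff_sum T f n x = (\<Sum>k=1..n. f ((T ^^ k) x))"

lemma birkhoff_sum_add:
  "birkhoff_sum T f (m + n) x = birkhoff_sum T f m x + birkhoff_sum T f n ((T ^^ m) x)"
proof -
  have "(\<Sum>k=m+1..m+n. f ((T ^^ k) x)) = (\<Sum>k=1..n. f ((T ^^ (k + m)) x))"
    using sum.shift_bounds_cl_nat_ivl[of "\<lambda>k. f ((T ^^ k) x)" 1 m n] by (simp add: add.commute)
  then show ?thesis
    unfolding birkhoff_sum_def
    using sum.ub_add_nat[of 1 m "\<lambda>k. f ((T ^^ k) x)" n] by (simp add: funpow_add)
qed

lemma funpow_in: "T ` X \<subseteq> X \<Longrightarrow> x \<in> X \<Longrightarrow> (T ^^ k) x \<in> X"
  by (induction k) auto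

lemma continuous_on_funpow:
  assumes "continuous_on X T" "T ` X \<subseteq> X"
  shows "continuous_on X (T ^^ k)"
proof (induction k)
  case (Suc k)
  have "(T ^^ k) ` X \<subseteq> X"
    using funpow_in[OF assms(2)] by auto
  then have "continuous_on X (T \<circ> (T ^^ k))"
    using Suc assms(1) by (intro continuous_on_compose) (auto intro: continuous_on_subset)
  then show ?case by simp
qed (simp add: id_def)

lemma continuous_on_birkhoff_sum:
  assumes "continuous_on X T" "T ` X \<subseteq> X" "continuous_on X f"
  shows "continuous_on X (birkhoff_sum T f n)"
  unfolding birkhoff_sum_def
proof (intro continuous_on_sum)
  fix k
  show "continuous_on X (\<lambda>x. f ((T ^^ k) x))"
    using funpow_in[OF assms(2)]
    by (intro continuous_on_compose2[OF assms(3) continuous_on_funpow[OF assms(1,2)]]) auto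
qed

lemma abs_birkhoff_sum_le:
  assumes "T ` X \<subseteq> X" "x \<in> X" "\<And>y. y \<in> X \<Longrightarrow> \<bar>f y\<bar> \<le> M"
  shows "\<bar>birkhoff_sum T f n x\<bar> \<le> real n * M"
proof -
  have "\<bar>birkhoff_sum T f n x\<bar> \<le> (\<Sum>k=1..n. \<bar>f ((T ^^ k) x)\<bar>)"
    unfolding birkhoff_sum_def by (rule sum_abs)
  also have "\<dots> \<le> (\<Sum>k=1..n. M)"
    by (intro sum_mono assms(3) funpow_in[OF assms(1,2)])
  finally show ?thesis by simp
qed

section \<open>From \<open>Fbar\<close>-closeness to closeness of averages\<close>

text \<open>The infimum runs over a finite non-empty set, so it is attained, and a strict bound on
  the upper limit yields an actual permutation at every large time.\<close>

lemma Fbar_less_imp_eventually: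
  assumes "Fbar T x y < ereal e"
  shows "\<forall>\<^sub>F n in sequentially. \<exists>\<sigma>. \<sigma> permutes {1..n} \<and>
           (1 / real n) * (\<Sum>k=1..n. dist ((T ^^ k) x) ((T ^^ \<sigma> k) y)) < e"
proof -
  let ?D = "\<lambda>n \<sigma>. (1 / real n) * (\<Sum>k=1..n. dist ((T ^^ k) x) ((T ^^ \<sigma> k) y))"
  have "\<forall>\<^sub>F n in sequentially. ereal (INF \<sigma>\<in>{\<sigma>. \<sigma> permutes {1..n}}. ?D n \<sigma>) < ereal e"
    using assms unfolding Fbar_def by (rule Limsup_lessD)
  then show ?thesis
  proof eventually_elim
    case (elim n)
    let ?P = "{\<sigma>. \<sigma> permutes {1..n}}"
    have "Inf S \<in> S" if "finite S" "S \<noteq> {}" for S :: "real set"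
      using that by (simp add: cInf_eq_Min)
    moreover have "?D n ` ?P \<noteq> {}"
      using permutes_id by blast
    moreover have "finite (?D n ` ?P)"
      by (intro finite_imageI finite_permutations) simp
    ultimately have "Inf (?D n ` ?P) \<in> ?D n ` ?P"
      by blast
    then show ?case
      using elim by auto
  qed
qed

text \<open>\<open>Fbar\<close> controls only the mean distance of matched points, so the modulus of
  continuity has to be affine in order to be summed. Near pairs cost \<open>e\<close>; for pairs at
  distance at least \<open>d\<close> the trivial bound \<open>2 * M\<close> is absorbed by the slope
  \<open>2 * M / d\<close>.\<close>

lemma uniformly_continuous_affine_modulus:
  fixes f :: "'a::metric_space \<Rightarrow> real"
  assumes "compact X" "continuous_on X f" "e > 0"
  obtains L where "L > 0" "\<And>u v. u \<in> X \<Longrightarrow> v \<in> X \<Longrightarrow> \<bar>f u - f v\<bar> \<le> e + L * dist u v"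
proof -
  have "bounded (f ` X)"
    using assms by (intro compact_imp_bounded compact_continuous_image)
  then obtain M where M: "M > 0" "\<And>u. u \<in> X \<Longrightarrow> \<bar>f u\<bar> \<le> M"
    unfolding bounded_pos by auto
  obtain d where d: "d > 0" "\<And>u v. u \<in> X \<Longrightarrow> v \<in> X \<Longrightarrow> dist v u < d \<Longrightarrow> dist (f v) (f u) < e"
    using compact_uniformly_continuous[OF assms(2,1)] assms(3)
    unfolding uniformly_continuous_on_def by metis
  show thesis
  proof (rule that[of "2 * M / d"])
    fix u v assume uv: "u \<in> X" "v \<in> X"
    show "\<bar>f u - f v\<bar> \<le> e + 2 * M / d * dist u v"
    proof (cases "dist u v < d")
      case True
      then have "\<bar>f u - f v\<bar> < e"
        using d(2)[OF uv(2,1)] by (simp add: dist_real_def)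
      moreover have "0 \<le> 2 * M / d * dist u v"
        using M d by simp
      ultimately show ?thesis by linarith
    next
      case False
      have "2 * M = 2 * M / d * d"
        using d by simp
      also have "\<dots> \<le> 2 * M / d * dist u v"
        using False M d by (intro mult_left_mono) auto
      finally show ?thesis
        using M(2)[OF uv(1)] M(2)[OF uv(2)] assms(3) by linarith
    qed
  qed (use M d in simp)
qed

lemma Fbar_continuous_birkhoff_average_close:
  assumes "topological_dynamical_system X T" "Fbar_continuous X T"
    and "continuous_on X f" "y \<in> X" "e > 0"
  obtains d where "d > 0"
    "\<And>z. z \<in> X \<Longrightarrow> dist y z < d \<Longrightarrow>
       \<forall>\<^sub>F n in sequentially. \<bar>birkhoff_sum T f n y - birkhoff_sum T f n z\<bar> \<le> real n * e"
proof -
  have X: "compact X" "T ` X \<subseteq> X"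
    using assms(1) unfolding topological_dynamical_system_def by auto
  obtain L where L: "L > 0"
    "\<And>u v. u \<in> X \<Longrightarrow> v \<in> X \<Longrightarrow> \<bar>f u - f v\<bar> \<le> e / 2 + L * dist u v"
    using uniformly_continuous_affine_modulus[OF X(1) assms(3), of "e / 2"] assms(5) by auto
  obtain d where d: "d > 0"
    \<comment> \<open>The radius \<open>e / (2 * L)\<close> turns into \<open>e / 2\<close> after
      multiplication by the slope \<open>L\<close>; the other \<open>e / 2\<close> is the constant
      term of the modulus.\<close>
    "\<And>z. z \<in> X \<Longrightarrow> dist y z < d \<Longrightarrow> Fbar T y z < ereal (e / (2 * L))"
  proof -
    have "e / (2 * L) > 0"
      using assms(5) L(1) by simp
    then show ?thesis
      using assms(2,4) that unfolding Fbar_continuous_def by blast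
  qed
  show thesis
  proof (rule that[OF d(1)])
    fix z assume z: "z \<in> X" "dist y z < d"
    show "\<forall>\<^sub>F n in sequentially. \<bar>birkhoff_sum T f n y - birkhoff_sum T f n z\<bar> \<le> real n * e"
      using Fbar_less_imp_eventually[OF d(2)[OF z]] eventually_gt_at_top[of 0]
    proof eventually_elim
      case (elim n)
      then obtain s where s: "s permutes {1..n}"
        "(1 / real n) * (\<Sum>k=1..n. dist ((T ^^ k) y) ((T ^^ s k) z)) < e / (2 * L)"
        by blast
      \<comment> \<open>Permuting the times does not change the sum at \<open>z\<close>, so the two
        orbits can be compared along the matching \<open>s\<close>.\<close>
      have "birkhoff_sum T f n z = (\<Sum>k=1..n. f ((T ^^ s k) z))"
        unfolding birkhoff_sum_def using sum.permute[OF s(1), of "\<lambda>k. f ((T ^^ k) z)"] by simp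
      then have "\<bar>birkhoff_sum T f n y - birkhoff_sum T f n z\<bar>
          = \<bar>\<Sum>k=1..n. f ((T ^^ k) y) - f ((T ^^ s k) z)\<bar>"
        by (simp add: birkhoff_sum_def sum_subtractf)
      also have "\<dots> \<le> (\<Sum>k=1..n. \<bar>f ((T ^^ k) y) - f ((T ^^ s k) z)\<bar>)"
        by (rule sum_abs)
      also have "\<dots> \<le> (\<Sum>k=1..n. e / 2 + L * dist ((T ^^ k) y) ((T ^^ s k) z))"
        by (intro sum_mono L(2) funpow_in[OF X(2)] assms(4) z(1))
      also have "\<dots> = real n * (e / 2) + L * (\<Sum>k=1..n. dist ((T ^^ k) y) ((T ^^ s k) z))"
        by (simp add: sum.distrib sum_distrib_left)
      also have "\<dots> \<le> real n * (e / 2) + L * (real n * (e / (2 * L)))"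
        using s(2) elim L(1) by (intro add_left_mono mult_left_mono) (auto simp: field_simps)
      also have "\<dots> = real n * e"
        using L(1) by (simp add: field_simps)
      finally show ?case .
    qed
  qed
qed

section \<open>Linear lower bounds on an orbit closure\<close>

text \<open>By compactness the good segments can be chosen of length at most some \<open>N\<close>.
  Cutting them off one after another leaves a remainder of length at most \<open>N\<close>, whose
  deficit is bounded independently of \<open>n\<close> and \<open>y\<close>.\<close>

lemma birkhoff_sum_lower_bound:
  assumes "compact K" "continuous_on K T" "T ` K \<subseteq> K" "continuous_on K f"
    and "\<And>y. y \<in> K \<Longrightarrow> \<exists>n\<ge>1. birkhoff_sum T f n y > a * real n"
  obtains C where "\<And>n y. y \<in> K \<Longrightarrow> birkhoff_sum T f n y \<ge> a * real n - C"
proof -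
  have "bounded (f ` K)"
    using assms by (intro compact_imp_bounded compact_continuous_image)
  then obtain M where M: "M > 0" "\<And>u. u \<in> K \<Longrightarrow> \<bar>f u\<bar> \<le> M"
    unfolding bounded_pos by auto
  define U where "U n = {y \<in> K. birkhoff_sum T f n y > a * real n}" for n
  have "openin (top_of_set K) (U n)" for n
  proof -
    have "U n = K \<inter> birkhoff_sum T f n -` {a * real n<..}"
      unfolding U_def by auto
    then show ?thesis
      using continuous_openin_preimage_gen[OF continuous_on_birkhoff_sum[OF assms(2-4)]]
      by simp
  qed
  moreover have "K \<subseteq> \<Union> (U ` {1..})"
    using assms(5) unfolding U_def by fastforce
  ultimately have "\<exists>D\<subseteq>U ` {1..}. finite D \<and> K \<subseteq> \<Union> D"
    using assms(1)[unfolded compact_eq_openin_cover, rule_format, of "U ` {1..}"] by blast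
  then obtain D where D: "D \<subseteq> U ` {1..}" "finite D" "K \<subseteq> \<Union> D"
    by blast
  obtain I where I: "I \<subseteq> {1..}" "finite I" "D = U ` I"
    using finite_subset_image[OF D(2,1)] by blast
  then obtain N where N: "\<And>n. n \<in> I \<Longrightarrow> n \<le> N"
    unfolding finite_nat_set_iff_bounded_le by blast
  \<comment> \<open>Worst deficit of a remainder: its sum is at least \<open>- (real N * M)\<close>,
    and \<open>a\<close> times its length is at most \<open>real N * \<bar>a\<bar>\<close>.\<close>
  define C where "C = real N * (M + \<bar>a\<bar>)"
  have "y \<in> K \<Longrightarrow> birkhoff_sum T f n y \<ge> a * real n - C" for n y
  proof (induction n arbitrary: y rule: less_induct)
    case (less n)
    show ?case
    proof (cases "n \<le> N")
      case True
      have "- (real n * M) \<le> birkhoff_sum T f n y"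
        using abs_birkhoff_sum_le[of T K y f M n, OF assms(3) less.prems M(2)] by linarith
      moreover have "a * real n \<le> \<bar>a\<bar> * real n"
        by (intro mult_right_mono) auto
      moreover have "real n * (M + \<bar>a\<bar>) \<le> C"
        unfolding C_def using True M(1) by (intro mult_right_mono) auto
      ultimately show ?thesis
        by (simp add: algebra_simps)
    next
      case False
      \<comment> \<open>A first segment of length \<open>m\<close> is cut off;
        \<open>1 \<le> m\<close> makes the induction on the remaining length descend.\<close>
      obtain m where m: "m \<in> I" "y \<in> U m"
        using D(3) I(3) less.prems by auto
      then have mn: "1 \<le> m" "m < n"
        using I(1) N[of m] False by auto
      have "birkhoff_sum T f (n - m) ((T ^^ m) y) \<ge> a * real (n - m) - C"
        using mn by (intro less.IH funpow_in[OF assms(3)] less.prems) auto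
      moreover have "birkhoff_sum T f m y > a * real m"
        using m(2) unfolding U_def by simp
      ultimately show ?thesis
        using birkhoff_sum_add[of T f m "n - m" y] mn by (simp add: of_nat_diff algebra_simps)
    qed
  qed
  then show thesis
    by (rule that)
qed

lemma birkhoff_average_eventually_gt:
  assumes "topological_dynamical_system X T" "Fbar_continuous X T"
    and "continuous_on X f" "x \<in> X" "e > 0"
    and freq: "\<exists>\<^sub>F n in sequentially. birkhoff_sum T f n x > b * real n"
  shows "\<forall>\<^sub>F n in sequentially. birkhoff_sum T f n x > (b - e) * real n"
proof -
  have X: "compact X" "continuous_on X T" "T ` X \<subseteq> X"
    using assms(1) unfolding topological_dynamical_system_def by auto
  have "bounded (f ` X)"
    using X(1) assms(3) by (intro compact_imp_bounded compact_continuous_image)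
  then obtain M where M: "M > 0" "\<And>u. u \<in> X \<Longrightarrow> \<bar>f u\<bar> \<le> M"
    unfolding bounded_pos by auto
  \<comment> \<open>Only points approximated by the orbit of \<open>x\<close> inherit its frequent
    excess over \<open>b\<close>, hence the restriction to the orbit closure.\<close>
  define K where "K = closure (range (\<lambda>k. (T ^^ k) x))"
  have orbit_X: "range (\<lambda>k. (T ^^ k) x) \<subseteq> X"
    using funpow_in[OF X(3) assms(4)] by auto
  then have KX: "K \<subseteq> X"
    unfolding K_def using X(1) by (simp add: closure_minimal compact_imp_closed)
  have "K = X \<inter> K"
    using KX by blast
  then have K: "compact K"
    using compact_Int_closed[OF X(1), of K] unfolding K_def by simp
  have "T ` range (\<lambda>k. (T ^^ k) x) \<subseteq> K"
  proof -
    have "T ((T ^^ k) x) \<in> range (\<lambda>k. (T ^^ k) x)" for k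
      using rangeI[of "\<lambda>k. (T ^^ k) x" "Suc k"] by simp
    then show ?thesis
      unfolding K_def using closure_subset by fastforce
  qed
  then have TK: "T ` K \<subseteq> K"
    using image_closure_subset[of "range (\<lambda>k. (T ^^ k) x)" T K] KX X(2)
    unfolding K_def by (simp add: continuous_on_subset)
  have pos: "\<exists>n\<ge>1. birkhoff_sum T f n y > (b - e / 2) * real n" if y: "y \<in> K" for y
  proof -
    \<comment> \<open>Of the loss \<open>e / 2\<close>, one \<open>e / 4\<close> pays for replacing
      \<open>y\<close> by a nearby orbit point and the other for moving the starting point from
      \<open>x\<close> to that point.\<close>
    obtain d where d: "d > 0"
      "\<And>z. z \<in> X \<Longrightarrow> dist y z < d \<Longrightarrow>
        \<forall>\<^sub>F n in sequentially. \<bar>birkhoff_sum T f n y - birkhoff_sum T f n z\<bar> \<le> real n * (e / 4)"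
      using Fbar_continuous_birkhoff_average_close[OF assms(1-3), of y "e / 4"] y KX assms(5)
      by auto
    obtain k where k: "dist y ((T ^^ k) x) < d"
      using y d(1) unfolding K_def closure_approachable by (auto simp: dist_commute)
    have zX: "(T ^^ k) x \<in> X"
      using orbit_X by auto
    \<comment> \<open>Shifting the start by \<open>k\<close> changes the sum by at most
      \<open>2 * (real k * M)\<close>, which is below \<open>real n * (e / 4)\<close> once
      \<open>n\<close> exceeds this \<open>N\<close>.\<close>
    obtain N :: nat where N: "real N > 8 * real k * M / e"
      using reals_Archimedean2 by blast
    have "\<exists>\<^sub>F n in sequentially. birkhoff_sum T f n x > b * real n \<and>
        \<bar>birkhoff_sum T f n y - birkhoff_sum T f n ((T ^^ k) x)\<bar> \<le> real n * (e / 4) \<and> n \<ge> N + 1"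
      using freq d(2)[OF zX k] eventually_ge_at_top[of "N + 1"]
      by (intro frequently_eventually_frequently eventually_conj)
    then obtain n where n: "birkhoff_sum T f n x > b * real n"
      "\<bar>birkhoff_sum T f n y - birkhoff_sum T f n ((T ^^ k) x)\<bar> \<le> real n * (e / 4)" "n \<ge> N + 1"
      using frequently_ex by fast
    \<comment> \<open>The sum over the first \<open>k + n\<close> times, split after
      \<open>k\<close> and after \<open>n\<close>.\<close>
    have "birkhoff_sum T f k x + birkhoff_sum T f n ((T ^^ k) x)
        = birkhoff_sum T f n x + birkhoff_sum T f k ((T ^^ n) x)"
      using birkhoff_sum_add[of T f k n x] birkhoff_sum_add[of T f n k x]
      by (simp add: add.commute)
    moreover have "\<bar>birkhoff_sum T f k x\<bar> \<le> real k * M"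
      by (rule abs_birkhoff_sum_le[OF X(3) assms(4) M(2)])
    moreover have "\<bar>birkhoff_sum T f k ((T ^^ n) x)\<bar> \<le> real k * M"
      by (rule abs_birkhoff_sum_le[OF X(3) funpow_in[OF X(3) assms(4)] M(2)])
    moreover have "2 * (real k * M) < real n * (e / 4)"
    proof -
      have "8 * real k * M / e < real n"
        using N n(3) by linarith
      then show ?thesis
        using assms(5) by (simp add: field_simps)
    qed
    ultimately have "birkhoff_sum T f n y > b * real n - real n * (e / 4) - real n * (e / 4)"
      using n(1,2) by linarith
    then have "birkhoff_sum T f n y > (b - e / 2) * real n"
      by (simp add: algebra_simps)
    then show ?thesis
      using n(3) by (intro exI[of _ n]) auto
  qed
  obtain C where C: "\<And>n y. y \<in> K \<Longrightarrow> birkhoff_sum T f n y \<ge> (b - e / 2) * real n - C"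
    using birkhoff_sum_lower_bound[OF K _ TK _ pos] X(2) assms(3) KX continuous_on_subset
    by metis
  have xK: "x \<in> K"
    unfolding K_def using rangeI[of "\<lambda>k. (T ^^ k) x" 0] by (intro subsetD[OF closure_subset]) simp
  \<comment> \<open>From here on the constant \<open>C\<close> costs less than the remaining
    \<open>e / 2\<close> per unit of time.\<close>
  obtain N :: nat where N: "real N > 2 * C / e"
    using reals_Archimedean2 by blast
  show ?thesis
    using eventually_ge_at_top[of N]
  proof eventually_elim
    case (elim n)
    have "2 * C / e < real n"
      using N elim by linarith
    then have "C < e / 2 * real n"
      using assms(5) by (simp add: field_simps)
    then show ?case
      using C[OF xK, of n] by (simp add: algebra_simps)
  qed
qed

section \<open>Convergence of the averages\<close>

text \<open>Boundedness makes the upper limit a real \<open>c\<close>. Values just below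
  \<open>c\<close> are exceeded frequently, hence, up to \<open>e\<close>, eventually; so the lower
  limit is at least \<open>c\<close>.\<close>

lemma convergent_if_frequently_imp_eventually:
  fixes u :: "nat \<Rightarrow> real"
  assumes "\<And>n. \<bar>u n\<bar> \<le> M"
    and "\<And>b e. e > 0 \<Longrightarrow> \<exists>\<^sub>F n in sequentially. u n > b \<Longrightarrow> \<forall>\<^sub>F n in sequentially. u n > b - e"
  shows "convergent u"
proof -
  define l where "l = limsup (\<lambda>n. ereal (u n))"
  have "l \<le> ereal M"
    unfolding l_def using assms(1) by (intro Limsup_bounded always_eventually) (auto simp: abs_le_iff)
  moreover have "ereal (- M) \<le> l"
    unfolding l_def
  proof (rule le_Limsup)
    show "\<forall>\<^sub>F n in sequentially. ereal (- M) \<le> ereal (u n)"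
      using assms(1) by (intro always_eventually allI) (simp add: abs_le_iff minus_le_iff)
  qed simp
  ultimately obtain c where c: "l = ereal c"
    by (cases l) auto
  have "u \<longlonglongrightarrow> c"
  proof (rule order_tendstoI)
    fix a assume "a < c"
    \<comment> \<open>Half of the gap is used to get below the upper limit, the other half is lost
      in the hypothesis.\<close>
    define e where "e = (c - a) / 2"
    have e: "e > 0" "c - e - e = a"
      using \<open>a < c\<close> unfolding e_def by (auto simp: field_simps)
    have "\<exists>\<^sub>F n in sequentially. u n > c - e"
    proof (rule ccontr)
      assume "\<not> ?thesis"
      then have "\<forall>\<^sub>F n in sequentially. ereal (u n) \<le> ereal (c - e)"
        by (simp add: frequently_def not_less)
      then have "l \<le> ereal (c - e)"
        unfolding l_def by (rule Limsup_bounded)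
      then show False
        using c e by simp
    qed
    from assms(2)[OF e(1) this] show "\<forall>\<^sub>F n in sequentially. a < u n"
      using e(2) by simp
  next
    fix a assume "c < a"
    then have "limsup (\<lambda>n. ereal (u n)) < ereal a"
      using c l_def by simp
    from Limsup_lessD[OF this] show "\<forall>\<^sub>F n in sequentially. u n < a"
      by simp
  qed
  then show ?thesis
    by (rule convergentI)
qed

theorem proposition6p1:
  fixes X :: "'a::metric_space set" and T :: "'a \<Rightarrow> 'a"
  assumes "topological_dynamical_system X T"
    and "Fbar_continuous X T"
  shows "\<forall>x\<in>X. generic_point X T x"
  unfolding generic_point_def
proof (intro ballI conjI allI impI)
  fix x f assume x: "x \<in> X" and f: "continuous_on X (f :: 'a \<Rightarrow> real)"
  have X: "compact X" "T ` X \<subseteq> X"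
    using assms(1) unfolding topological_dynamical_system_def by auto
  have "bounded (f ` X)"
    using X(1) f by (intro compact_imp_bounded compact_continuous_image)
  then obtain M where M: "M > 0" "\<And>u. u \<in> X \<Longrightarrow> \<bar>f u\<bar> \<le> M"
    unfolding bounded_pos by auto
  define u where "u n = (1 / real n) * birkhoff_sum T f n x" for n
  \<comment> \<open>Time 0 is excluded because there the left side reads \<open>0 > b\<close> and
    the right side \<open>0 > 0\<close>.\<close>
  have gt_iff: "u n > b \<longleftrightarrow> birkhoff_sum T f n x > b * real n" if "n > 0" for n b
    using that unfolding u_def by (simp add: field_simps)
  have "convergent u"
  proof (rule convergent_if_frequently_imp_eventually)
    fix n
    show "\<bar>u n\<bar> \<le> M"
    proof (cases "n = 0")
      case False
      then show ?thesis
        using abs_birkhoff_sum_le[of T X x f M n, OF X(2) x M(2)]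
        unfolding u_def by (simp add: abs_mult field_simps)
    qed (use M(1) in \<open>simp add: u_def\<close>)
  next
    fix b e :: real
    assume e: "e > 0" and "\<exists>\<^sub>F n in sequentially. u n > b"
    then have "\<exists>\<^sub>F n in sequentially. u n > b \<and> n > 0"
      by (intro frequently_eventually_frequently eventually_gt_at_top)
    then have "\<exists>\<^sub>F n in sequentially. birkhoff_sum T f n x > b * real n"
      by (rule frequently_elim1) (use gt_iff in blast)
    from birkhoff_average_eventually_gt[OF assms f x e this] eventually_gt_at_top[of 0]
    show "\<forall>\<^sub>F n in sequentially. u n > b - e"
      by eventually_elim (simp add: gt_iff)
  qed
  then show "convergent (\<lambda>n. (1 / real n) * (\<Sum>k=1..n. f ((T ^^ k) x)))"
    unfolding u_def birkhoff_sum_def .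
qed

end
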